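(* Let $A=R[y_1;\alpha_1,\nu_1]_p[y_2;\alpha_2,\nu_2]_p$ be an iterated Poisson polynomial extension over a Poisson algebra $R$ such that - $\alpha_2(R)\subset R$, - $\nu_2(R)\subset Ry_1+R$, - $\alpha_2(y_1)=\mu_{12}y_1+w_2$ for some $\mu_{12}\in{\bf k}$ and $w_2\in R$, - $\nu_2(y_1)=\mu_{11}y_1^2+w_1y_1+w_0$ for some $\mu_{11}\in{\bf k}$ and $w_1,w_0\in R$. Let $\nu_2^1,\nu_2^0:R\to R$ be the ${\bf k}$-linear maps with $\nu_2(a)=\nu_2^1(a)y_1+\nu_2^0(a)$ for all $a\in R$. Then $A$ is a Poisson double extension of $R$ with variables $y_1,y_2$ and PDE-data $\{q,\alpha,\nu,w\}$, where $$q=\{\mu_{11},\mu_{12}\},\quad \alpha(a)=\begin{pmatrix}\alpha_1(a)&0\\ \nu_2^1(a)&\alpha_2(a)\end{pmatrix},\quad \nu(a)=\begin{pmatrix}\nu_1(a)\\ \nu_2^0(a)\end{pmatrix},\quad w=\{w_1,w_2,w_0\}.$$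
   Context: ${\bf k}$ is a field of characteristic zero. A Poisson algebra is a commutative ${\bf k}$-algebra with a ${\bf k}$-bilinear bracket $\{-,-\}$ making it a Lie algebra and such that each $\{a,-\}$ is a derivation. Poisson polynomial extension: for derivations $\beta,\nu$ of a Poisson algebra $R$, the polynomial ring $R[x]$ is a Poisson algebra containing $R$ as a Poisson subalgebra with $\{x,a\}=\beta(a)x+\nu(a)$ for all $a\in R$ if and only if $\beta$ is a Poisson derivation (i.e. also a derivation of the bracket) and $\nu(\{a,b\})=\{\nu(a),b\}+\{a,\nu(b)\}+\beta(a)\nu(b)-\nu(a)\beta(b)$ for all $a,b\in R$; this Poisson algebra is denoted $R[x;\beta,\nu]_p$. In the iterated extension $R[y_1;\alpha_1,\nu_1]_p[y_2;\alpha_2,\nu_2]_p$, the maps $\alpha_2,\nu_2$ are derivations of $R[y_1;\alpha_1,\nu_1]_p$. A Poisson double extension of a Poisson algebra $R$ with variables $y_1,y_2$ and PDE-data $\{q,\alpha,\nu,w\}$, where $q=\{q_{11},q_{12}\}\subset{\bf k}$, $w=\{w_1,w_2,w_0\}\subset R$, $\alpha=(\alpha_{ij}):R\to M_{2\times 2}(R)$ and $\nu=(\nu_1,\nu_2)^T:R\to M_{2\times1}(R)$ are ${\bf k}$-linear, is the commutative polynomial ring $R[y_1,y_2]$ endowed with a Poisson bracket that restricts to the given bracket on $R$ and satisfies $\{y_2,y_1\}=q_{11}y_1^2+q_{12}y_1y_2+w_1y_1+w_2y_2+w_0$ and $\{y_i,a\}=\alpha_{i1}(a)y_1+\alpha_{i2}(a)y_2+\nu_i(a)$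 for $i=1,2$ and $a\in R$. *)

theory Defs
  imports "HOL-Analysis.Cartesian_Space" "HOL-Computational_Algebra.Polynomial"
begin

text \<open>The ground field of characteristic zero is the type \<open>'k\<close>; it acts on a commutative
  ring with unit through \<open>scl\<close>.\<close>

locale comm_algebra = vector_space scl
  for scl :: "'k::field_char_0 \<Rightarrow> 'a::comm_ring_1 \<Rightarrow> 'a" +
  assumes scale_mult_left: "scl c (a * b) = scl c a * b"

definition derivation :: "('k::field_char_0 \<Rightarrow> 'a::comm_ring_1 \<Rightarrow> 'a) \<Rightarrow> ('a \<Rightarrow> 'a) \<Rightarrow> bool"
  where "derivation scl d \<longleftrightarrow>
    Vector_Spaces.linear scl scl d \<and> (\<forall>a b. d (a * b) = d a * b + a * d b)"

locale poisson_algebra = comm_algebra scl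
  for scl :: "'k::field_char_0 \<Rightarrow> 'a::comm_ring_1 \<Rightarrow> 'a" +
  fixes bracket :: "'a \<Rightarrow> 'a \<Rightarrow> 'a"
  assumes linear_bracket_left: "Vector_Spaces.linear scl scl (\<lambda>a. bracket a b)"
    and linear_bracket_right: "Vector_Spaces.linear scl scl (bracket a)"
    and bracket_self: "bracket a a = 0"
    and jacobi: "bracket a (bracket b c) + bracket b (bracket c a) + bracket c (bracket a b) = 0"
    and derivation_bracket: "derivation scl (bracket a)"

definition poly_scale :: "('k \<Rightarrow> 'a \<Rightarrow> 'a) \<Rightarrow> 'k \<Rightarrow> 'a::zero poly \<Rightarrow> 'a poly"
  where "poly_scale scl c = map_poly (scl c)"

text \<open>\<open>poisson_poly_ext scl br \<beta> \<nu> br'\<close> says that \<open>br'\<close> is the bracket of the Poisson polynomial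
  extension \<open>R[x; \<beta>, \<nu>]\<^sub>p\<close> of the Poisson algebra \<open>R\<close> with bracket \<open>br\<close>. Since \<open>R\<close> and \<open>x\<close>
  generate \<open>R[x]\<close>, there is at most one such \<open>br'\<close>; it exists iff \<open>\<beta>\<close> is a Poisson
  derivation and \<open>\<nu>\<close> satisfies the usual compatibility condition with \<open>\<beta>\<close> and \<open>br\<close>.\<close>

definition poisson_poly_ext ::
  "('k::field_char_0 \<Rightarrow> 'a::comm_ring_1 \<Rightarrow> 'a) \<Rightarrow> ('a \<Rightarrow> 'a \<Rightarrow> 'a) \<Rightarrow> ('a \<Rightarrow> 'a) \<Rightarrow> ('a \<Rightarrow> 'a)
    \<Rightarrow> ('a poly \<Rightarrow> 'a poly \<Rightarrow> 'a poly) \<Rightarrow> bool"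
  where "poisson_poly_ext scl br \<beta> \<nu> br' \<longleftrightarrow>
    poisson_algebra scl br \<and> derivation scl \<beta> \<and> derivation scl \<nu> \<and>
    poisson_algebra (poly_scale scl) br' \<and>
    (\<forall>a b. br' [:a:] [:b:] = [:br a b:]) \<and>
    (\<forall>a. br' [:0, 1:] [:a:] = [:\<beta> a:] * [:0, 1:] + [:\<nu> a:])"

text \<open>The polynomial ring \<open>R[y\<^sub>1, y\<^sub>2]\<close> is \<open>R[y\<^sub>1][y\<^sub>2]\<close>, the type \<open>'a poly poly\<close>: the variable
  \<open>y\<^sub>2\<close> is the outer one.\<close>

abbreviation const2 :: "'a::zero \<Rightarrow> 'a poly poly" where "const2 a \<equiv> [:[:a:]:]"
abbreviation Y1 :: "'a::comm_ring_1 poly poly" where "Y1 \<equiv> [:[:0, 1:]:]"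
abbreviation Y2 :: "'a::comm_ring_1 poly poly" where "Y2 \<equiv> [:0, 1:]"

text \<open>\<open>poisson_double_ext scl br q \<alpha> \<nu> w br'\<close> says that \<open>R[y\<^sub>1, y\<^sub>2]\<close> with bracket \<open>br'\<close> is a Poisson
  double extension of the Poisson algebra \<open>R\<close> with bracket \<open>br\<close>, with PDE-data
  \<open>q = (q\<^sub>1\<^sub>1, q\<^sub>1\<^sub>2)\<close>, \<open>\<alpha>\<close>, \<open>\<nu>\<close>, \<open>w = (w\<^sub>1, w\<^sub>2, w\<^sub>0)\<close> (in this order).\<close>

definition poisson_double_ext ::
  "('k::field_char_0 \<Rightarrow> 'a::comm_ring_1 \<Rightarrow> 'a) \<Rightarrow> ('a \<Rightarrow> 'a \<Rightarrow> 'a)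
    \<Rightarrow> 'k \<times> 'k \<Rightarrow> ('a \<Rightarrow> 'a ^ 2 ^ 2) \<Rightarrow> ('a \<Rightarrow> 'a ^ 2) \<Rightarrow> 'a \<times> 'a \<times> 'a
    \<Rightarrow> ('a poly poly \<Rightarrow> 'a poly poly \<Rightarrow> 'a poly poly) \<Rightarrow> bool"
  where "poisson_double_ext scl br q \<alpha> \<nu> w br' \<longleftrightarrow>
    poisson_algebra scl br \<and>
    (\<forall>i j. Vector_Spaces.linear scl scl (\<lambda>a. \<alpha> a $ i $ j)) \<and>
    (\<forall>i. Vector_Spaces.linear scl scl (\<lambda>a. \<nu> a $ i)) \<and>
    poisson_algebra (poly_scale (poly_scale scl)) br' \<and>
    (\<forall>a b. br' (const2 a) (const2 b) = const2 (br a b)) \<and>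
    (case q of (q11, q12) \<Rightarrow> case w of (w1, w2, w0) \<Rightarrow>
      br' Y2 Y1 =
        poly_scale (poly_scale scl) q11 (Y1 ^ 2) + poly_scale (poly_scale scl) q12 (Y1 * Y2)
        + const2 w1 * Y1 + const2 w2 * Y2 + const2 w0) \<and>
    (\<forall>a. br' Y1 (const2 a) =
        const2 (\<alpha> a $ 1 $ 1) * Y1 + const2 (\<alpha> a $ 1 $ 2) * Y2 + const2 (\<nu> a $ 1)) \<and>
    (\<forall>a. br' Y2 (const2 a) =
        const2 (\<alpha> a $ 2 $ 1) * Y1 + const2 (\<alpha> a $ 2 $ 2) * Y2 + const2 (\<nu> a $ 2))"

end

theory Submission
  imports Defs
begin

text \<open>The iterated extension already carries its Poisson bracket on R[y1][y2], so only the
  defining relations and the linearity of the data remain. Elements of R[y1] are constants for the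
  outer variable, on which \<open>brA\<close> is \<open>br1\<close>; hence {y1,a} = \<alpha>1(a) y1
  + \<nu>1(a). The outer relation {y2,p} = \<alpha>2(p) y2 + \<nu>2(p), taken at p = a and p = y1,
  gives the other two. Linearity of \<open>\<alpha>2R\<close>, \<open>\<nu>21\<close> and
  \<open>\<nu>20\<close> comes from comparing coefficients in the linearity of
  \<open>\<alpha>2\<close> and \<open>\<nu>2\<close>.\<close>

text \<open>\<open>map_poly\<close> passes through \<open>pCons\<close> for maps fixing 0, and
  scaling by c does so in any vector space. Stated there, the rule serves both R and R[y1] as
  coefficients.\<close>

lemma (in vector_space) poly_scale_pCons:
  "poly_scale scale c (pCons a p) = pCons (scale c a) (poly_scale scale c p)"
  by (simp add: poly_scale_def map_poly_pCons)

lemma poly_scale_0 [simp]: "poly_scale scl c 0 = 0"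
  by (simp add: poly_scale_def)

theorem proposition4p3:
  fixes scl :: "'k::field_char_0 \<Rightarrow> 'a::comm_ring_1 \<Rightarrow> 'a"
    and br :: "'a \<Rightarrow> 'a \<Rightarrow> 'a"
    and \<alpha>1 \<nu>1 :: "'a \<Rightarrow> 'a"
    and br1 :: "'a poly \<Rightarrow> 'a poly \<Rightarrow> 'a poly"
    and \<alpha>2 \<nu>2 :: "'a poly \<Rightarrow> 'a poly"
    and brA :: "'a poly poly \<Rightarrow> 'a poly poly \<Rightarrow> 'a poly poly"
    and \<mu>11 \<mu>12 :: 'k
    and w0 w1 w2 :: 'a
    and \<alpha>2R \<nu>21 \<nu>20 :: "'a \<Rightarrow> 'a"
  assumes R: "poisson_algebra scl br"
    and ext1: "poisson_poly_ext scl br \<alpha>1 \<nu>1 br1"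
    and ext2: "poisson_poly_ext (poly_scale scl) br1 \<alpha>2 \<nu>2 brA"
    and \<alpha>2_R: "\<alpha>2 ` range (\<lambda>a. [:a:]) \<subseteq> range (\<lambda>a. [:a:])"
    and \<nu>2_R: "\<nu>2 ` range (\<lambda>a. [:a:]) \<subseteq> {[:b:] * [:0, 1:] + [:c:] | b c. True}"
    and \<alpha>2_y1: "\<alpha>2 [:0, 1:] = poly_scale scl \<mu>12 [:0, 1:] + [:w2:]"
    and \<nu>2_y1: "\<nu>2 [:0, 1:] = poly_scale scl \<mu>11 ([:0, 1:] ^ 2) + [:w1:] * [:0, 1:] + [:w0:]"
    and \<alpha>2R: "\<And>a. \<alpha>2 [:a:] = [:\<alpha>2R a:]"
    and \<nu>21_\<nu>20: "\<And>a. \<nu>2 [:a:] = [:\<nu>21 a:] * [:0, 1:] + [:\<nu>20 a:]"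
  shows "poisson_double_ext scl br (\<mu>11, \<mu>12)
    (\<lambda>a. vector [vector [\<alpha>1 a, 0], vector [\<nu>21 a, \<alpha>2R a]])
    (\<lambda>a. vector [\<nu>1 a, \<nu>20 a])
    (w1, w2, w0) brA"
proof -
  interpret R: poisson_algebra scl br by (fact R)
  from ext1 have der1: "derivation scl \<alpha>1" "derivation scl \<nu>1"
    and P1: "poisson_algebra (poly_scale scl) br1"
    and br1_const: "\<And>a b. br1 [:a:] [:b:] = [:br a b:]"
    and br1_y1: "\<And>a. br1 [:0, 1:] [:a:] = [:\<alpha>1 a:] * [:0, 1:] + [:\<nu>1 a:]"
    by (auto simp: poisson_poly_ext_def)
  from ext2 have der2: "derivation (poly_scale scl) \<alpha>2" "derivation (poly_scale scl) \<nu>2"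
    and PA: "poisson_algebra (poly_scale (poly_scale scl)) brA"
    and brA_const: "\<And>p q. brA [:p:] [:q:] = [:br1 p q:]"
    and brA_y2: "\<And>p. brA Y2 [:p:] = [:\<alpha>2 p:] * Y2 + [:\<nu>2 p:]"
    by (auto simp: poisson_poly_ext_def)
  interpret P1: poisson_algebra "poly_scale scl" br1 by (fact P1)
  note scale_simps = R.poly_scale_pCons P1.poly_scale_pCons
  have lin1: "Vector_Spaces.linear scl scl \<alpha>1" "Vector_Spaces.linear scl scl \<nu>1"
    using der1 by (auto simp: derivation_def)
  interpret \<alpha>2: Vector_Spaces.linear "poly_scale scl" "poly_scale scl" \<alpha>2
    using der2 by (simp add: derivation_def)
  interpret \<nu>2: Vector_Spaces.linear "poly_scale scl" "poly_scale scl" \<nu>2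
    using der2 by (simp add: derivation_def)
  have linI: "Vector_Spaces.linear scl scl f"
    if "\<And>a b. f (a + b) = f a + f b" "\<And>c a. f (scl c a) = scl c (f a)" for f :: "'a \<Rightarrow> 'a"
    using that by unfold_locales auto
  \<comment> \<open>This is the upper right entry of the matrix: {y1,a} has no y2 term.\<close>
  have lin_zero: "Vector_Spaces.linear scl scl (\<lambda>a. 0)"
    by (rule linI) auto
  have lin_\<alpha>2R: "Vector_Spaces.linear scl scl \<alpha>2R"
  proof (rule linI)
    show "\<alpha>2R (a + b) = \<alpha>2R a + \<alpha>2R b" for a b
      using \<alpha>2.add[of "[:a:]" "[:b:]"] by (simp add: \<alpha>2R)
    show "\<alpha>2R (scl c a) = scl c (\<alpha>2R a)" for c a
      using \<alpha>2.scale[of c "[:a:]"] by (simp add: \<alpha>2R scale_simps)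
  qed
  \<comment> \<open>As a coefficient list, so that injectivity of \<open>pCons\<close> separates the
    identities for \<open>\<nu>20\<close> and \<open>\<nu>21\<close>.\<close>
  have \<nu>2_const: "\<nu>2 [:a:] = [:\<nu>20 a, \<nu>21 a:]" for a
    by (simp add: \<nu>21_\<nu>20)
  have lin_\<nu>2: "Vector_Spaces.linear scl scl \<nu>21" "Vector_Spaces.linear scl scl \<nu>20"
  proof -
    have add: "[:\<nu>20 (a + b), \<nu>21 (a + b):] = [:\<nu>20 a + \<nu>20 b, \<nu>21 a + \<nu>21 b:]" for a b
      using \<nu>2.add[of "[:a:]" "[:b:]"] by (simp add: \<nu>2_const)
    have scale: "[:\<nu>20 (scl c a), \<nu>21 (scl c a):] = [:scl c (\<nu>20 a), scl c (\<nu>21 a):]" for c a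
      using \<nu>2.scale[of c "[:a:]"] by (simp add: \<nu>2_const scale_simps)
    show "Vector_Spaces.linear scl scl \<nu>21" "Vector_Spaces.linear scl scl \<nu>20"
      using add scale by (auto intro!: linI)
  qed
  \<comment> \<open>\<open>Y1\<close> is constant in y2, so this is \<open>brA_y2\<close> at p = y1:
    \<alpha>2(y1) y2 supplies the terms with \<mu>12 and \<open>w2\<close>, and \<nu>2(y1) the
    rest.\<close>
  have y2y1: "brA Y2 Y1 =
      poly_scale (poly_scale scl) \<mu>11 (Y1 ^ 2) + poly_scale (poly_scale scl) \<mu>12 (Y1 * Y2)
      + const2 w1 * Y1 + const2 w2 * Y2 + const2 w0"
    by (simp add: brA_y2 \<alpha>2_y1 \<nu>2_y1 scale_simps power2_eq_square)
  \<comment> \<open>Both arguments lie in R[y1], where \<open>brA\<close> restricts to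
    \<open>br1\<close>.\<close>
  have y1: "brA Y1 (const2 a) = const2 (\<alpha>1 a) * Y1 + const2 (\<nu>1 a)" for a
    by (simp add: brA_const br1_y1)
  have y2: "brA Y2 (const2 a)
      = const2 (\<nu>21 a) * Y1 + const2 (\<alpha>2R a) * Y2 + const2 (\<nu>20 a)" for a
    by (simp add: brA_y2 \<alpha>2R \<nu>21_\<nu>20)
  show ?thesis
    using R PA lin1 lin_zero lin_\<alpha>2R lin_\<nu>2 y2y1 y1 y2
    by (simp add: poisson_double_ext_def forall_2 brA_const br1_const)
qed

end
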